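(* Let $K$ be a field, let $f\colon A\to B$ be a morphism of $K$-coalgebras, let $N$ be a positive integer, and let $\Omega_t=\sum_{n=0}^N\omega_n t^n$, with $\omega_n=(\Delta_{A,n};\,\Delta_{B,n};\,f_n)\in C^2_c(f)$, be a deformation of $f$ of order $N$. Let $\omega_{N+1}=(\Delta_{A,N+1};\,\Delta_{B,N+1};\,f_{N+1})\in C^2_c(f)$ be a $2$-cochain and set $\widetilde\Omega_t=\Omega_t+\omega_{N+1}t^{N+1}$. For $X\in\{A,B\}$ put $$\mathrm{Ob}_X=\sum_{i=1}^N\Big((\Delta_{X,i}\otimes \mathrm{Id}_X)\circ\Delta_{X,N+1-i}-(\mathrm{Id}_X\otimes\Delta_{X,i})\circ\Delta_{X,N+1-i}\Big),$$ put $$\mathrm{Ob}_F=\sum_{\substack{i+j+k=N+1\\ 0\le i,j,k\le N}}(f_j\otimes f_k)\circ\Delta_{A,i}\;-\;\sum_{i=1}^N\Delta_{B,N+1-i}\circ f_i ,$$ and let $\mathrm{Ob}_\Omega=(\mathrm{Ob}_A;\,\mathrm{Ob}_B;\,\mathrm{Ob}_F)\in C^3_c(f)$. Then $\widetilde\Omega_t$ is a deformation of $f$ of order $N+1$ if and only if $\mathrm{Ob}_\Omega=d_c\,\omega_{N+1}$.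
   Context: Fix a ground field $K$; $\otimes$ and $\mathrm{Hom}$ are over $K$. A $K$-coalgebra is a pair $(A,\Delta_A)$ with $A$ a $K$-vector space and $\Delta_A\colon A\to A\otimes A$ a $K$-linear map that is coassociative: $(\mathrm{Id}\otimes\Delta_A)\Delta_A=(\Delta_A\otimes\mathrm{Id})\Delta_A$ (no counit is required). A morphism $f\colon A\to B$ of coalgebras is a linear map with $\Delta_B\circ f=(f\otimes f)\circ\Delta_A$. Hochschild coalgebra cochains. For a coalgebra $A$ and an $A$-bicomodule $M$ with structure maps $\psi_l\colon M\to A\otimes M$ and $\psi_r\colon M\to M\otimes A$, set $C^n_c(M,A)=\mathrm{Hom}_K(M,A^{\otimes n})$ for $n\ge1$, $C^0_c(M,A)=0$, with differential $\delta_c\colon C^n_c(M,A)\to C^{n+1}_c(M,A)$, $$\delta_c\sigma=(\mathrm{Id}_A\otimes\sigma)\circ\psi_l+\sum_{i=1}^n(-1)^i(\mathrm{Id}_{A^{\otimes(i-1)}}\otimes\Delta_A\otimes\mathrm{Id}_{A^{\otimes(n-i)}})\circ\sigma+(-1)^{n+1}(\sigma\otimes\mathrm{Id}_A)\circ\psi_r .$$ A coalgebra $A$ is a bicomodule over itself with $\psi_l=\psi_r=\Delta_A$. Given a coalgebra morphism $f\colon A\to B$, $A$ is a $B$-bicomodule via $\psi_l=(f\otimes\mathrm{Id}_A)\circ\Delta_A$ and $\psi_r=(\mathrm{Id}_A\otimes f)\circ\Delta_A$; $C^*_c(A,B)$ refers to this structure. Deformation complex of $f$. For $n\ge1$, $C^n_c(f)=C^n_c(A,A)\times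 C^n_c(B,B)\times C^{n-1}_c(A,B)$, with differential $d_c\colon C^n_c(f)\to C^{n+1}_c(f)$, $$d_c(\xi;\pi;\varphi)=\big(\delta_c\xi;\ \delta_c\pi;\ \pi\circ f-f^{\otimes n}\circ\xi-\delta_c\varphi\big).$$ Deformation of order $N$. For a positive integer $N$, a deformation of $f$ of order $N$ is a polynomial $\Omega_t=\sum_{n=0}^N\omega_nt^n$ with $\omega_n=(\Delta_{A,n};\Delta_{B,n};f_n)\in C^2_c(f)$ and $\omega_0=(\Delta_A;\Delta_B;f)$ such that, for $X\in\{A,B\}$, $\Delta_{X,t}=\sum_{n=0}^N\Delta_{X,n}t^n$ is coassociative modulo $t^{N+1}$ (so it defines a $K[t]/(t^{N+1})$-coalgebra structure on $X[t]/(t^{N+1})$), and $F_t=\sum_{n=0}^Nf_nt^n$ satisfies $\Delta_{B,t}\circ F_t=(F_t\otimes F_t)\circ\Delta_{A,t}$ modulo $t^{N+1}$ (so it is a $K[t]/(t^{N+1})$-coalgebra morphism). *)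

theory Defs
  imports
    Complex_Main
    "HOL-Library.Function_Algebras"
    "HOL-Library.Product_Plus"
    "HOL-Computational_Algebra.Polynomial"
begin

section \<open>Tensor products\<close>

text \<open>
  A \<open>K\<close>-vector space is a type with a scalar multiplication satisfying
  \<^const>\<open>vector_space\<close>.  Tensor products of such spaces are modelled without quotients:
  a pure tensor is evaluation at a tuple, seen as a functional on the multilinear forms, and
  the tensor product is the span of the pure tensors.  Functionals are required to ignore
  non-multilinear arguments (they give 0 there), so that equality of tensors is equality
  of HOL functions.  Lemmas \<open>tensor_power_universal\<close> and \<open>tensor_product_universal\<close> below
  establish the universal property, so these are tensor products in the usual sense.

  The vector space operations \<open>+\<close>, \<open>-\<close>, \<open>0\<close> on functions are the pointwise ones.
\<close>

type_synonym ('x, 'k) tens = "('x \<Rightarrow> 'k) \<Rightarrow> 'k"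

definition tscale :: "'k::field \<Rightarrow> ('x, 'k) tens \<Rightarrow> ('x, 'k) tens" where
  "tscale c T = (\<lambda>\<phi>. c * T \<phi>)"

definition eval_on :: "('x \<Rightarrow> 'k) set \<Rightarrow> 'x \<Rightarrow> ('x, 'k::field) tens" where
  "eval_on \<Phi> x = (\<lambda>\<phi>. if \<phi> \<in> \<Phi> then \<phi> x else 0)"

definition multilinear ::
  "('k::field \<Rightarrow> 'a::ab_group_add \<Rightarrow> 'a) \<Rightarrow> ('k \<Rightarrow> 'u::ab_group_add \<Rightarrow> 'u) \<Rightarrow> nat \<Rightarrow> ('a list \<Rightarrow> 'u) \<Rightarrow> bool"
  where
  "multilinear s sU n \<beta> \<longleftrightarrow>
     (\<forall>xs ys. length xs + Suc (length ys) = n \<longrightarrow> Vector_Spaces.linear s sU (\<lambda>a. \<beta> (xs @ a # ys)))"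

definition bilinear_map ::
  "('k::field \<Rightarrow> 'v::ab_group_add \<Rightarrow> 'v) \<Rightarrow> ('k \<Rightarrow> 'w::ab_group_add \<Rightarrow> 'w) \<Rightarrow>
   ('k \<Rightarrow> 'u::ab_group_add \<Rightarrow> 'u) \<Rightarrow> ('v \<times> 'w \<Rightarrow> 'u) \<Rightarrow> bool"
  where
  "bilinear_map sV sW sU \<beta> \<longleftrightarrow>
     (\<forall>w. Vector_Spaces.linear sV sU (\<lambda>v. \<beta> (v, w))) \<and>
     (\<forall>v. Vector_Spaces.linear sW sU (\<lambda>w. \<beta> (v, w)))"

text \<open>\<open>tensor s [a\<^sub>1, \<dots>, a\<^sub>n]\<close> is \<open>a\<^sub>1 \<otimes> \<dots> \<otimes> a\<^sub>n\<close> and \<open>tensor_power s n\<close> is \<open>A\<^sup>\<otimes>\<^sup>n\<close>.\<close>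

definition tensor :: "('k::field \<Rightarrow> 'a::ab_group_add \<Rightarrow> 'a) \<Rightarrow> 'a list \<Rightarrow> ('a list, 'k) tens" where
  "tensor s xs = eval_on {\<phi>. multilinear s (*) (length xs) \<phi>} xs"

definition tensor_power :: "('k::field \<Rightarrow> 'a::ab_group_add \<Rightarrow> 'a) \<Rightarrow> nat \<Rightarrow> ('a list, 'k) tens set" where
  "tensor_power s n = module.span tscale (tensor s ` {xs. length xs = n})"

text \<open>The tensor product \<open>V \<otimes> W\<close> of two spaces of different types.\<close>

definition tensor2 ::
  "('k::field \<Rightarrow> 'v::ab_group_add \<Rightarrow> 'v) \<Rightarrow> ('k \<Rightarrow> 'w::ab_group_add \<Rightarrow> 'w) \<Rightarrow> 'v \<times> 'w \<Rightarrow> ('v \<times> 'w, 'k) tens"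
  where
  "tensor2 sV sW p = eval_on {\<phi>. bilinear_map sV sW (*) \<phi>} p"

definition tensor_product ::
  "('k::field \<Rightarrow> 'v::ab_group_add \<Rightarrow> 'v) \<Rightarrow> ('k \<Rightarrow> 'w::ab_group_add \<Rightarrow> 'w) \<Rightarrow> ('v \<times> 'w, 'k) tens set"
  where
  "tensor_product sV sW = module.span tscale (range (tensor2 sV sW))"

text \<open>
  \<open>lift \<beta>\<close> is the linear map on tensors with \<open>x\<^sub>1 \<otimes> \<dots> \<otimes> x\<^sub>n \<mapsto> \<beta> [x\<^sub>1, \<dots>, x\<^sub>n]\<close> (respectively
  \<open>v \<otimes> w \<mapsto> \<beta> (v, w)\<close>) for multilinear (bilinear) \<open>\<beta>\<close> with values in a space of tensors;
  see \<open>lift_tensor\<close> and \<open>lift_tensor2\<close>.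
\<close>

definition lift :: "('x \<Rightarrow> ('y, 'k) tens) \<Rightarrow> ('x, 'k) tens \<Rightarrow> ('y, 'k) tens" where
  "lift \<beta> T = (\<lambda>\<psi>. T (\<lambda>x. \<beta> x \<psi>))"

text \<open>The identification \<open>A\<^sup>\<otimes>\<^sup>p \<otimes> A\<^sup>\<otimes>\<^sup>q = A\<^sup>\<otimes>\<^sup>p\<^sup>+\<^sup>q\<close>, as a product on tensors.\<close>

definition tmult ::
  "('k::field \<Rightarrow> 'a::ab_group_add \<Rightarrow> 'a) \<Rightarrow> ('a list, 'k) tens \<Rightarrow> ('a list, 'k) tens \<Rightarrow> ('a list, 'k) tens"
  where
  "tmult s T U = lift (\<lambda>xs. lift (\<lambda>ys. tensor s (xs @ ys)) U) T"

text \<open>The identification \<open>A = A\<^sup>\<otimes>\<^sup>1\<close>.\<close>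

definition tone :: "('k::field \<Rightarrow> 'a::ab_group_add \<Rightarrow> 'a) \<Rightarrow> 'a \<Rightarrow> ('a list, 'k) tens" where
  "tone s a = tensor s [a]"

text \<open>
  \<open>tmap s \<sigma> \<tau>\<close> is \<open>\<sigma> \<otimes> \<tau> : A \<otimes> A \<rightarrow> C\<^sup>\<otimes>\<^sup>p\<^sup>+\<^sup>q\<close> for \<open>\<sigma> : A \<rightarrow> C\<^sup>\<otimes>\<^sup>p\<close> and \<open>\<tau> : A \<rightarrow> C\<^sup>\<otimes>\<^sup>q\<close>, where \<open>s\<close> is the
  scalar multiplication of \<open>C\<close>; an ordinary map \<open>g : A \<rightarrow> C\<close> enters as \<open>tone s \<circ> g\<close>,
  and the identity as \<open>tone s\<close>.
\<close>

definition tmap ::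
  "('k::field \<Rightarrow> 'c::ab_group_add \<Rightarrow> 'c) \<Rightarrow> ('a \<Rightarrow> ('c list, 'k) tens) \<Rightarrow> ('a \<Rightarrow> ('c list, 'k) tens) \<Rightarrow>
   ('a list, 'k) tens \<Rightarrow> ('c list, 'k) tens"
  where
  "tmap s \<sigma> \<tau> = lift (\<lambda>xs. tmult s (\<sigma> (xs ! 0)) (\<tau> (xs ! 1)))"

text \<open>\<open>f\<^sup>\<otimes>\<^sup>n : A\<^sup>\<otimes>\<^sup>n \<rightarrow> B\<^sup>\<otimes>\<^sup>n\<close>, for all \<open>n\<close> at once (\<open>sB\<close> belongs to the codomain).\<close>

definition tpower_map ::
  "('k::field \<Rightarrow> 'b::ab_group_add \<Rightarrow> 'b) \<Rightarrow> ('a \<Rightarrow> 'b) \<Rightarrow> ('a list, 'k) tens \<Rightarrow> ('b list, 'k) tens"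
  where
  "tpower_map sB f = lift (\<lambda>xs. tensor sB (map f xs))"

text \<open>\<open>Id\<^bsub>A\<^sup>\<otimes>\<^sup>(\<^sup>i\<^sup>-\<^sup>1\<^sup>)\<^esub> \<otimes> \<Delta> \<otimes> Id\<^bsub>A\<^sup>\<otimes>\<^sup>(\<^sup>n\<^sup>-\<^sup>i\<^sup>)\<^esub>\<close> on \<open>A\<^sup>\<otimes>\<^sup>n\<close>, for \<open>1 \<le> i \<le> n\<close>.\<close>

definition comult_at ::
  "('k::field \<Rightarrow> 'a::ab_group_add \<Rightarrow> 'a) \<Rightarrow> ('a \<Rightarrow> ('a list, 'k) tens) \<Rightarrow> nat \<Rightarrow>
   ('a list, 'k) tens \<Rightarrow> ('a list, 'k) tens"
  where
  "comult_at s \<Delta> i =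
     lift (\<lambda>xs. tmult s (tensor s (take (i - 1) xs)) (tmult s (\<Delta> (xs ! (i - 1))) (tensor s (drop i xs))))"

subsection \<open>Universal properties\<close>

lemma vector_space_tscale: "vector_space (tscale :: 'k::field \<Rightarrow> ('x, 'k) tens \<Rightarrow> _)"
  by unfold_locales (auto simp: tscale_def fun_eq_iff algebra_simps)

lemma linear_apply: "Vector_Spaces.linear tscale (*) (\<lambda>T::('x, 'k::field) tens. T \<psi>)"
proof -
  interpret V: vector_space "tscale :: 'k \<Rightarrow> ('x, 'k) tens \<Rightarrow> _" by (rule vector_space_tscale)
  show ?thesis
    by unfold_locales (auto simp: tscale_def algebra_simps)
qed

lemma linear_comp:
  "Vector_Spaces.linear s1 s2 f \<Longrightarrow> Vector_Spaces.linear s2 s3 g \<Longrightarrow> Vector_Spaces.linear s1 s3 (\<lambda>x. g (f x))"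
  using Vector_Spaces.linear_compose[of s1 s2 f s3 g] by (simp add: o_def)

lemma multilinear_comp:
  "multilinear s sU n \<beta> \<Longrightarrow> Vector_Spaces.linear sU sV l \<Longrightarrow> multilinear s sV n (\<lambda>x. l (\<beta> x))"
  unfolding multilinear_def using linear_comp[of s sU "\<lambda>a. \<beta> (_ @ a # _)" sV l] by simp

lemma bilinear_map_comp:
  "bilinear_map sV sW sU \<beta> \<Longrightarrow> Vector_Spaces.linear sU sX l \<Longrightarrow> bilinear_map sV sW sX (\<lambda>x. l (\<beta> x))"
  unfolding bilinear_map_def
  using linear_comp[of sV sU "\<lambda>v. \<beta> (v, _)" sX l] linear_comp[of sW sU "\<lambda>w. \<beta> (_, w)" sX l] by simp

lemma linear_lift: "Vector_Spaces.linear tscale tscale (lift \<beta> :: ('x, 'k::field) tens \<Rightarrow> ('y, 'k) tens)"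
proof -
  interpret V: vector_space "tscale :: 'k \<Rightarrow> ('x, 'k) tens \<Rightarrow> _" by (rule vector_space_tscale)
  interpret W: vector_space "tscale :: 'k \<Rightarrow> ('y, 'k) tens \<Rightarrow> _" by (rule vector_space_tscale)
  show ?thesis
    by unfold_locales (auto simp: tscale_def lift_def fun_eq_iff)
qed

lemma lift_tensor:
  "multilinear s tscale (length xs) \<beta> \<Longrightarrow> lift \<beta> (tensor s xs) = \<beta> xs"
  using multilinear_comp[of s tscale "length xs" \<beta> "(*)" "\<lambda>T. T \<psi>" for \<psi>, OF _ linear_apply]
  by (simp add: lift_def tensor_def eval_on_def fun_eq_iff)

lemma lift_tensor2:
  "bilinear_map sV sW tscale \<beta> \<Longrightarrow> lift \<beta> (tensor2 sV sW p) = \<beta> p"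
  using bilinear_map_comp[of sV sW tscale \<beta> "(*)" "\<lambda>T. T \<psi>" for \<psi>, OF _ linear_apply]
  by (simp add: lift_def tensor2_def eval_on_def fun_eq_iff)

lemma separating_functional:
  assumes "vector_space (s :: 'k::field \<Rightarrow> 'u::ab_group_add \<Rightarrow> 'u)" and "u \<noteq> 0"
  shows "\<exists>l. Vector_Spaces.linear s (*) l \<and> l u \<noteq> 0"
proof -
  interpret vector_space_pair s "(*) :: 'k \<Rightarrow> 'k \<Rightarrow> 'k"
    using assms(1) by (intro vector_space_pair.intro) (auto intro: vector_space.intro simp: algebra_simps)
  have "vs1.independent {u}" using \<open>u \<noteq> 0\<close> by simp
  then show ?thesis
    using linear_independent_extend[of "{u}" "\<lambda>_. 1"] by fastforce
qed

lemma eval_on_universal: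
  fixes \<beta> :: "'x \<Rightarrow> 'u::ab_group_add" and sU :: "'k::field \<Rightarrow> 'u \<Rightarrow> 'u"
  assumes U: "vector_space sU"
    and \<Phi>: "\<And>l. Vector_Spaces.linear sU (*) l \<Longrightarrow> (\<lambda>x. l (\<beta> x)) \<in> \<Phi>"
  shows "\<exists>h. Vector_Spaces.linear tscale sU h \<and> (\<forall>x\<in>X. h (eval_on \<Phi> x) = \<beta> x)"
proof -
  interpret vector_space_pair "tscale :: 'k \<Rightarrow> ('x, 'k) tens \<Rightarrow> _" sU
    by (intro vector_space_pair.intro vector_space_tscale U)
  obtain B where B: "B \<subseteq> eval_on \<Phi> ` X" "vs1.independent B" "eval_on \<Phi> ` X \<subseteq> vs1.span B"
    using vs1.maximal_independent_subset[of "eval_on \<Phi> ` X"] by blast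
  define g where "g b = \<beta> (SOME x. x \<in> X \<and> eval_on \<Phi> x = b)" for b
  have g: "b \<phi> = l (g b)" if "b \<in> B" and l: "Vector_Spaces.linear sU (*) l" and \<phi>: "\<phi> = (\<lambda>x. l (\<beta> x))"
    for b l \<phi>
  proof -
    have "\<exists>x. x \<in> X \<and> eval_on \<Phi> x = b" using B that(1) by auto
    from someI_ex[OF this] show ?thesis
      using \<Phi>[OF l] unfolding g_def \<phi> by (auto simp: eval_on_def dest!: fun_cong[where x = "\<lambda>x. l (\<beta> x)"])
  qed
  obtain h where h: "Vector_Spaces.linear tscale sU h" "\<And>b. b \<in> B \<Longrightarrow> h b = g b"
    using linear_independent_extend[OF B(2), of g] by auto
  have "h (eval_on \<Phi> x) = \<beta> x" if "x \<in> X" for x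
  proof (rule ccontr)
    assume "h (eval_on \<Phi> x) \<noteq> \<beta> x"
    then obtain l where l: "Vector_Spaces.linear sU (*) l" "l (h (eval_on \<Phi> x) - \<beta> x) \<noteq> 0"
      using separating_functional[OF U, of "h (eval_on \<Phi> x) - \<beta> x"] by auto
    interpret l: Vector_Spaces.linear sU "(*)" l by (rule l(1))
    interpret p: vector_space_pair "tscale :: 'k \<Rightarrow> ('x, 'k) tens \<Rightarrow> _" "(*) :: 'k \<Rightarrow> 'k \<Rightarrow> 'k" ..
    have "l (h (eval_on \<Phi> x)) = eval_on \<Phi> x (\<lambda>x. l (\<beta> x))"
    proof (rule p.linear_eq_on[OF linear_comp[OF h(1) l(1)] linear_apply])
      show "eval_on \<Phi> x \<in> vs1.span B" using B(3) that by auto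
      show "l (h b) = b (\<lambda>x. l (\<beta> x))" if "b \<in> B" for b
        using g[OF that l(1) refl] h(2)[OF that] by simp
    qed
    also have "\<dots> = l (\<beta> x)" using \<Phi>[OF l(1)] by (simp add: eval_on_def)
    finally show False using l(2) by (simp add: l.diff)
  qed
  with h(1) show ?thesis by blast
qed

lemma linear_tensI:
  fixes g :: "'a::ab_group_add \<Rightarrow> ('x, 'k::field) tens"
  assumes "vector_space s" and "\<And>\<phi>. Vector_Spaces.linear s (*) (\<lambda>a. g a \<phi>)"
  shows "Vector_Spaces.linear s tscale g"
proof -
  have "g (a + b) \<phi> = g a \<phi> + g b \<phi>" "g (s c a) \<phi> = c * g a \<phi>" for a b c \<phi>
    using assms(2)[of \<phi>] by (simp_all add: Vector_Spaces.linear_iff_module_hom module_hom_iff)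
  then show ?thesis
    using assms(1) vector_space_tscale[where ?'k = 'k and ?'x = 'x]
    by (simp add: Vector_Spaces.linear_iff_module_hom module_hom_iff module_iff_vector_space
        fun_eq_iff tscale_def)
qed

lemma linear_zero_functional:
  "vector_space (s :: 'k::field \<Rightarrow> 'a::ab_group_add \<Rightarrow> 'a) \<Longrightarrow> Vector_Spaces.linear s (*) (\<lambda>_. 0 :: 'k)"
  by (simp add: Vector_Spaces.linear_iff_module_hom module_hom_iff module_iff_vector_space
      vector_space_def algebra_simps)

lemma multilinear_tensor:
  fixes s :: "'k::field \<Rightarrow> 'a::ab_group_add \<Rightarrow> 'a"
  shows "vector_space s \<Longrightarrow> multilinear s tscale n (tensor s)"
  unfolding multilinear_def
proof (intro allI impI linear_tensI)
  fix xs ys :: "'a list" and \<phi> :: "'a list \<Rightarrow> 'k" assume "vector_space s" "length xs + Suc (length ys) = n"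
  then show "Vector_Spaces.linear s (*) (\<lambda>a. tensor s (xs @ a # ys) \<phi>)"
    by (cases "multilinear s (*) n \<phi>") (simp_all add: tensor_def eval_on_def linear_zero_functional, simp add: multilinear_def)
qed

lemma bilinear_tensor2:
  fixes sV :: "'k::field \<Rightarrow> 'v::ab_group_add \<Rightarrow> 'v" and sW :: "'k \<Rightarrow> 'w::ab_group_add \<Rightarrow> 'w"
  shows "vector_space sV \<Longrightarrow> vector_space sW \<Longrightarrow> bilinear_map sV sW tscale (tensor2 sV sW)"
  unfolding bilinear_map_def
proof (intro allI conjI linear_tensI)
  fix v w and \<phi> :: "'v \<times> 'w \<Rightarrow> 'k" assume *: "vector_space sV" "vector_space sW"
  show "Vector_Spaces.linear sV (*) (\<lambda>v. tensor2 sV sW (v, w) \<phi>)"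
    using * by (cases "bilinear_map sV sW (*) \<phi>")
      (simp_all add: tensor2_def eval_on_def linear_zero_functional, simp add: bilinear_map_def)
  show "Vector_Spaces.linear sW (*) (\<lambda>w. tensor2 sV sW (v, w) \<phi>)"
    using * by (cases "bilinear_map sV sW (*) \<phi>")
      (simp_all add: tensor2_def eval_on_def linear_zero_functional, simp add: bilinear_map_def)
qed

lemma linear_eq_on_tens_span:
  fixes h h' :: "('x, 'k::field) tens \<Rightarrow> 'u::ab_group_add"
  assumes "Vector_Spaces.linear tscale sU h" "Vector_Spaces.linear tscale sU h'"
    and "\<And>x. x \<in> X \<Longrightarrow> h x = h' x" and "T \<in> module.span tscale X"
  shows "h T = h' T"
proof -
  interpret h: Vector_Spaces.linear "tscale :: 'k \<Rightarrow> ('x, 'k) tens \<Rightarrow> _" sU h by (rule assms(1))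
  interpret module_pair "tscale :: 'k \<Rightarrow> ('x, 'k) tens \<Rightarrow> _" sU ..
  show ?thesis
    using assms by (intro module_hom_eq_on_span[of h h' X T]) (auto simp: module_hom_iff_linear)
qed

theorem tensor_power_universal:
  assumes "vector_space sU" and "multilinear s sU n \<beta>"
  shows "\<exists>h. Vector_Spaces.linear tscale sU h \<and> (\<forall>xs. length xs = n \<longrightarrow> h (tensor s xs) = \<beta> xs)"
    and "Vector_Spaces.linear tscale sU h \<Longrightarrow> Vector_Spaces.linear tscale sU h' \<Longrightarrow>
      (\<And>xs. length xs = n \<Longrightarrow> h (tensor s xs) = h' (tensor s xs)) \<Longrightarrow>
      T \<in> tensor_power s n \<Longrightarrow> h T = h' T"
proof -
  show "\<exists>h. Vector_Spaces.linear tscale sU h \<and> (\<forall>xs. length xs = n \<longrightarrow> h (tensor s xs) = \<beta> xs)"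
    using eval_on_universal[OF assms(1), of \<beta> "{\<phi>. multilinear s (*) n \<phi>}" "{xs. length xs = n}"]
      multilinear_comp[OF assms(2), of "(*)"]
    by (simp add: tensor_def)
  show "h T = h' T" if "Vector_Spaces.linear tscale sU h" "Vector_Spaces.linear tscale sU h'"
      "\<And>xs. length xs = n \<Longrightarrow> h (tensor s xs) = h' (tensor s xs)" "T \<in> tensor_power s n"
    using linear_eq_on_tens_span[OF that(1,2) _ that(4)[unfolded tensor_power_def]] that(3) by blast
qed

theorem tensor_product_universal:
  assumes "vector_space sU" and "bilinear_map sV sW sU \<beta>"
  shows "\<exists>h. Vector_Spaces.linear tscale sU h \<and> (\<forall>p. h (tensor2 sV sW p) = \<beta> p)"
    and "Vector_Spaces.linear tscale sU h \<Longrightarrow> Vector_Spaces.linear tscale sU h' \<Longrightarrow>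
      (\<And>p. h (tensor2 sV sW p) = h' (tensor2 sV sW p)) \<Longrightarrow>
      T \<in> tensor_product sV sW \<Longrightarrow> h T = h' T"
proof -
  show "\<exists>h. Vector_Spaces.linear tscale sU h \<and> (\<forall>p. h (tensor2 sV sW p) = \<beta> p)"
    using eval_on_universal[OF assms(1), of \<beta> "{\<phi>. bilinear_map sV sW (*) \<phi>}" UNIV]
      bilinear_map_comp[OF assms(2), of "(*)"]
    by (simp add: tensor2_def)
  show "h T = h' T" if "Vector_Spaces.linear tscale sU h" "Vector_Spaces.linear tscale sU h'"
      "\<And>p. h (tensor2 sV sW p) = h' (tensor2 sV sW p)" "T \<in> tensor_product sV sW"
    using linear_eq_on_tens_span[OF that(1,2) _ that(4)[unfolded tensor_product_def]] that(3) by blast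
qed


subsection \<open>The identifications \<open>A\<^sup>\<otimes>\<^sup>p \<otimes> A\<^sup>\<otimes>\<^sup>q = A\<^sup>\<otimes>\<^sup>p\<^sup>+\<^sup>q\<close> and \<open>A = A\<^sup>\<otimes>\<^sup>1\<close>\<close>

lemma tmult_tensor:
  assumes "vector_space s"
  shows "tmult s (tensor s xs) (tensor s ys) = tensor s (xs @ ys)"
proof -
  have 1: "multilinear s tscale n (\<lambda>ys. tensor s (zs @ ys))" for zs n
    using multilinear_tensor[OF assms, of "length zs + n", unfolded multilinear_def, rule_format, of "zs @ _"]
    unfolding multilinear_def by simp
  have 2: "multilinear s tscale n (\<lambda>xs. tensor s (xs @ ys))" for n
    using multilinear_tensor[OF assms, of "n + length ys", unfolded multilinear_def, rule_format, of _ "_ @ ys"]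
    unfolding multilinear_def by simp
  show ?thesis unfolding tmult_def by (simp add: lift_tensor[OF 1] lift_tensor[OF 2])
qed

lemma linear_tone: "vector_space s \<Longrightarrow> Vector_Spaces.linear s tscale (tone s)"
  using multilinear_tensor[of s 1] by (auto simp: tone_def[abs_def] multilinear_def dest!: spec[of _ "[]"])

lemma bij_betw_tone:
  fixes s :: "'k::field \<Rightarrow> 'a::ab_group_add \<Rightarrow> 'a"
  assumes "vector_space s"
  shows "bij_betw (tone s) UNIV (tensor_power s 1)"
  unfolding bij_betw_def
proof
  interpret h: Vector_Spaces.linear s "tscale :: 'k \<Rightarrow> ('a list, 'k) tens \<Rightarrow> _" "tone s"
    by (rule linear_tone[OF assms])
  show "inj (tone s)"
  proof (rule injI, rule ccontr)
    fix x y assume e: "tone s x = tone s y" and "x \<noteq> y"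
    then obtain l where l: "Vector_Spaces.linear s (*) l" "l (x - y) \<noteq> 0"
      using separating_functional[OF assms, of "x - y"] by auto
    interpret l: Vector_Spaces.linear s "(*)" l by (rule l(1))
    have "multilinear s (*) 1 (\<lambda>xs. l (xs ! 0))" using l(1) by (auto simp: multilinear_def)
    then have "l x = l y"
      using fun_cong[OF e, of "\<lambda>xs. l (xs ! 0)"] by (auto simp: tone_def tensor_def eval_on_def)
    then show False using l(2) by (simp add: l.diff)
  qed
  have "tensor s ` {xs. length xs = 1} = range (tone s)"
    by (auto simp: tone_def[abs_def] length_Suc_conv image_iff)
  moreover have "h.vs2.span (range (tone s)) = range (tone s)"
    using h.span_image[of UNIV] by (simp only: h.vs1.span_UNIV)
  ultimately show "range (tone s) = tensor_power s 1"
    by (simp only: tensor_power_def)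
qed


section \<open>Coalgebras and the deformation complex of a morphism\<close>

text \<open>\<open>Hom\<^sub>K(M, A\<^sup>\<otimes>\<^sup>n)\<close>.\<close>

definition tensor_hom ::
  "('k::field \<Rightarrow> 'm::ab_group_add \<Rightarrow> 'm) \<Rightarrow> ('k \<Rightarrow> 'a::ab_group_add \<Rightarrow> 'a) \<Rightarrow> nat \<Rightarrow> ('m \<Rightarrow> ('a list, 'k) tens) set"
  where
  "tensor_hom sM sA n = {\<sigma>. Vector_Spaces.linear sM tscale \<sigma> \<and> range \<sigma> \<subseteq> tensor_power sA n}"

text \<open>\<open>A \<otimes> A\<close> is taken to be \<open>A\<^sup>\<otimes>\<^sup>2\<close>, so that a comultiplication is literally a 2-cochain.\<close>

locale coalgebra = vector_space scale
  for scale :: "'k::field \<Rightarrow> 'a::ab_group_add \<Rightarrow> 'a" +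
  fixes \<Delta> :: "'a \<Rightarrow> ('a list, 'k) tens"
  assumes comult_hom: "\<Delta> \<in> tensor_hom scale scale 2"
    and coassoc: "tmap scale (tone scale) \<Delta> \<circ> \<Delta> = tmap scale \<Delta> (tone scale) \<circ> \<Delta>"

locale coalgebra_morphism =
  A: coalgebra sA \<Delta>A + B: coalgebra sB \<Delta>B + Vector_Spaces.linear sA sB f
  for sA :: "'k::field \<Rightarrow> 'a::ab_group_add \<Rightarrow> 'a" and \<Delta>A :: "'a \<Rightarrow> ('a list, 'k) tens"
    and sB :: "'k \<Rightarrow> 'b::ab_group_add \<Rightarrow> 'b" and \<Delta>B :: "'b \<Rightarrow> ('b list, 'k) tens"
    and f :: "'a \<Rightarrow> 'b" +
  assumes morphism: "\<Delta>B \<circ> f = tmap sB (tone sB \<circ> f) (tone sB \<circ> f) \<circ> \<Delta>A"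

text \<open>
  \<open>C\<^sup>n(M, A)\<close> and its differential, for a coalgebra \<open>(A, \<Delta>)\<close> with scalar multiplication \<open>s\<close> and a
  bicomodule \<open>M\<close> with coactions \<open>\<psi>l : M \<rightarrow> A \<otimes> M\<close> and \<open>\<psi>r : M \<rightarrow> M \<otimes> A\<close>.
\<close>

definition cochains ::
  "('k::field \<Rightarrow> 'm::ab_group_add \<Rightarrow> 'm) \<Rightarrow> ('k \<Rightarrow> 'a::ab_group_add \<Rightarrow> 'a) \<Rightarrow> nat \<Rightarrow> ('m \<Rightarrow> ('a list, 'k) tens) set"
  where
  "cochains sM sA n = (if n = 0 then {0} else tensor_hom sM sA n)"

definition coboundary ::
  "('k::field \<Rightarrow> 'a::ab_group_add \<Rightarrow> 'a) \<Rightarrow> ('a \<Rightarrow> ('a list, 'k) tens) \<Rightarrow>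
   ('m \<Rightarrow> ('a \<times> 'm, 'k) tens) \<Rightarrow> ('m \<Rightarrow> ('m \<times> 'a, 'k) tens) \<Rightarrow> nat \<Rightarrow>
   ('m \<Rightarrow> ('a list, 'k) tens) \<Rightarrow> ('m \<Rightarrow> ('a list, 'k) tens)"
  where
  "coboundary s \<Delta> \<psi>l \<psi>r n \<sigma> = (\<lambda>m.
     lift (\<lambda>(a, m'). tmult s (tone s a) (\<sigma> m')) (\<psi>l m)
     + (\<Sum>i = 1..n. tscale ((-1) ^ i) (comult_at s \<Delta> i (\<sigma> m)))
     + tscale ((-1) ^ (n + 1)) (lift (\<lambda>(m', a). tmult s (\<sigma> m') (tone s a)) (\<psi>r m)))"

text \<open>
  The coactions \<open>(f \<otimes> Id) \<circ> \<Delta>\<^sub>A\<close> and \<open>(Id \<otimes> f) \<circ> \<Delta>\<^sub>A\<close> on \<open>A\<close>.  For \<open>f = id\<close> both are \<open>\<Delta>\<^sub>A\<close> up to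
  the identification of \<open>A\<^sup>\<otimes>\<^sup>2\<close> with the binary tensor product.
\<close>

definition left_coaction ::
  "('k::field \<Rightarrow> 'a::ab_group_add \<Rightarrow> 'a) \<Rightarrow> ('k \<Rightarrow> 'b::ab_group_add \<Rightarrow> 'b) \<Rightarrow>
   ('a \<Rightarrow> ('a list, 'k) tens) \<Rightarrow> ('a \<Rightarrow> 'b) \<Rightarrow> 'a \<Rightarrow> ('b \<times> 'a, 'k) tens"
  where
  "left_coaction sA sB \<Delta>A f = lift (\<lambda>xs. tensor2 sB sA (f (xs ! 0), xs ! 1)) \<circ> \<Delta>A"

definition right_coaction ::
  "('k::field \<Rightarrow> 'a::ab_group_add \<Rightarrow> 'a) \<Rightarrow> ('k \<Rightarrow> 'b::ab_group_add \<Rightarrow> 'b) \<Rightarrow>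
   ('a \<Rightarrow> ('a list, 'k) tens) \<Rightarrow> ('a \<Rightarrow> 'b) \<Rightarrow> 'a \<Rightarrow> ('a \<times> 'b, 'k) tens"
  where
  "right_coaction sA sB \<Delta>A f = lift (\<lambda>xs. tensor2 sA sB (xs ! 0, f (xs ! 1))) \<circ> \<Delta>A"

text \<open>The differentials of \<open>C\<^sup>*(A, A)\<close> and of \<open>C\<^sup>*(A, B)\<close>.\<close>

definition coboundary_self ::
  "('k::field \<Rightarrow> 'a::ab_group_add \<Rightarrow> 'a) \<Rightarrow> ('a \<Rightarrow> ('a list, 'k) tens) \<Rightarrow> nat \<Rightarrow>
   ('a \<Rightarrow> ('a list, 'k) tens) \<Rightarrow> ('a \<Rightarrow> ('a list, 'k) tens)"
  where
  "coboundary_self s \<Delta> = coboundary s \<Delta> (left_coaction s s \<Delta> id) (right_coaction s s \<Delta> id)"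

definition coboundary_along ::
  "('k::field \<Rightarrow> 'a::ab_group_add \<Rightarrow> 'a) \<Rightarrow> ('a \<Rightarrow> ('a list, 'k) tens) \<Rightarrow>
   ('k \<Rightarrow> 'b::ab_group_add \<Rightarrow> 'b) \<Rightarrow> ('b \<Rightarrow> ('b list, 'k) tens) \<Rightarrow> ('a \<Rightarrow> 'b) \<Rightarrow> nat \<Rightarrow>
   ('a \<Rightarrow> ('b list, 'k) tens) \<Rightarrow> ('a \<Rightarrow> ('b list, 'k) tens)"
  where
  "coboundary_along sA \<Delta>A sB \<Delta>B f =
     coboundary sB \<Delta>B (left_coaction sA sB \<Delta>A f) (right_coaction sA sB \<Delta>A f)"

type_synonym ('a, 'b, 'k) mor_cochain =
  "('a \<Rightarrow> ('a list, 'k) tens) \<times> ('b \<Rightarrow> ('b list, 'k) tens) \<times> ('a \<Rightarrow> ('b list, 'k) tens)"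

definition mor_cochains ::
  "('k::field \<Rightarrow> 'a::ab_group_add \<Rightarrow> 'a) \<Rightarrow> ('k \<Rightarrow> 'b::ab_group_add \<Rightarrow> 'b) \<Rightarrow> nat \<Rightarrow> ('a, 'b, 'k) mor_cochain set"
  where
  "mor_cochains sA sB n = cochains sA sA n \<times> cochains sB sB n \<times> cochains sA sB (n - 1)"

fun mor_coboundary ::
  "('k::field \<Rightarrow> 'a::ab_group_add \<Rightarrow> 'a) \<Rightarrow> ('a \<Rightarrow> ('a list, 'k) tens) \<Rightarrow>
   ('k \<Rightarrow> 'b::ab_group_add \<Rightarrow> 'b) \<Rightarrow> ('b \<Rightarrow> ('b list, 'k) tens) \<Rightarrow> ('a \<Rightarrow> 'b) \<Rightarrow> nat \<Rightarrow>
   ('a, 'b, 'k) mor_cochain \<Rightarrow> ('a, 'b, 'k) mor_cochain"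
  where
  "mor_coboundary sA \<Delta>A sB \<Delta>B f n (\<xi>, \<pi>, \<phi>) =
     (coboundary_self sA \<Delta>A n \<xi>,
      coboundary_self sB \<Delta>B n \<pi>,
      (\<pi> \<circ> f) - (tpower_map sB f \<circ> \<xi>) - coboundary_along sA \<Delta>A sB \<Delta>B f (n - 1) \<phi>)"


section \<open>Deformations of finite order\<close>

text \<open>
  The coefficients of a deformation are triples \<open>(\<Delta>\<^sub>A\<^sub>,\<^sub>n, \<Delta>\<^sub>B\<^sub>,\<^sub>n, f\<^sub>n)\<close> with \<open>f\<^sub>n : A \<rightarrow> B\<close>; they are
  2-cochains once \<open>B\<close> is identified with \<open>B\<^sup>\<otimes>\<^sup>1\<close>.
\<close>

type_synonym ('a, 'b, 'k) coeff2 =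
  "('a \<Rightarrow> ('a list, 'k) tens) \<times> ('b \<Rightarrow> ('b list, 'k) tens) \<times> ('a \<Rightarrow> 'b)"

fun as_cochain ::
  "('k::field \<Rightarrow> 'b::ab_group_add \<Rightarrow> 'b) \<Rightarrow> ('a, 'b, 'k) coeff2 \<Rightarrow> ('a, 'b, 'k) mor_cochain" where
  "as_cochain sB (D, E, g) = (D, E, tone sB \<circ> g)"

text \<open>
  The \<open>K[t]\<close>-bilinear extension of \<open>b\<close>, used for the composition and the tensor product of
  polynomials in \<open>t\<close> whose coefficients are linear maps.
\<close>

definition poly_ext ::
  "('p::comm_monoid_add \<Rightarrow> 'q::comm_monoid_add \<Rightarrow> 'r::comm_monoid_add) \<Rightarrow> 'p poly \<Rightarrow> 'q poly \<Rightarrow> 'r poly"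
  where
  "poly_ext b P Q = (\<Sum>i\<le>degree P. \<Sum>j\<le>degree Q. monom (b (coeff P i) (coeff Q j)) (i + j))"

text \<open>Congruence modulo \<open>t\<^sup>N\<^sup>+\<^sup>1\<close>.\<close>

definition cong_upto :: "nat \<Rightarrow> 'p::zero poly \<Rightarrow> 'p poly \<Rightarrow> bool" where
  "cong_upto N P Q \<longleftrightarrow> (\<forall>n\<le>N. coeff P n = coeff Q n)"

definition coassoc_upto ::
  "('k::field \<Rightarrow> 'a::ab_group_add \<Rightarrow> 'a) \<Rightarrow> nat \<Rightarrow> ('a \<Rightarrow> ('a list, 'k) tens) poly \<Rightarrow> bool" where
  "coassoc_upto s N D \<longleftrightarrow>
     cong_upto N
       (poly_ext (\<circ>) (poly_ext (tmap s) [:tone s:] D) D)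
       (poly_ext (\<circ>) (poly_ext (tmap s) D [:tone s:]) D)"

definition morphism_upto ::
  "('k::field \<Rightarrow> 'b::ab_group_add \<Rightarrow> 'b) \<Rightarrow> nat \<Rightarrow> ('a \<Rightarrow> ('a list, 'k) tens) poly \<Rightarrow>
   ('b \<Rightarrow> ('b list, 'k) tens) poly \<Rightarrow> ('a::ab_group_add \<Rightarrow> 'b) poly \<Rightarrow> bool"
  where
  "morphism_upto sB N DA DB F \<longleftrightarrow>
     cong_upto N
       (poly_ext (\<circ>) DB F)
       (poly_ext (\<circ>) (poly_ext (\<lambda>g h. tmap sB (tone sB \<circ> g) (tone sB \<circ> h)) F F) DA)"

abbreviation "partA \<equiv> map_poly fst"
abbreviation "partB \<equiv> map_poly (fst \<circ> snd)"
abbreviation "partF \<equiv> map_poly (snd \<circ> snd)"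

definition deformation ::
  "('k::field \<Rightarrow> 'a::ab_group_add \<Rightarrow> 'a) \<Rightarrow> ('a \<Rightarrow> ('a list, 'k) tens) \<Rightarrow>
   ('k \<Rightarrow> 'b::ab_group_add \<Rightarrow> 'b) \<Rightarrow> ('b \<Rightarrow> ('b list, 'k) tens) \<Rightarrow> ('a \<Rightarrow> 'b) \<Rightarrow> nat \<Rightarrow>
   ('a, 'b, 'k) coeff2 poly \<Rightarrow> bool"
  where
  "deformation sA \<Delta>A sB \<Delta>B f N \<Omega> \<longleftrightarrow>
     degree \<Omega> \<le> N \<and>
     (\<forall>n\<le>N. as_cochain sB (coeff \<Omega> n) \<in> mor_cochains sA sB 2) \<and>
     coeff \<Omega> 0 = (\<Delta>A, \<Delta>B, f) \<and>
     coassoc_upto sA N (partA \<Omega>) \<and>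
     coassoc_upto sB N (partB \<Omega>) \<and>
     morphism_upto sB N (partA \<Omega>) (partB \<Omega>) (partF \<Omega>)"

definition obstruction_comult ::
  "('k::field \<Rightarrow> 'a::ab_group_add \<Rightarrow> 'a) \<Rightarrow> nat \<Rightarrow> ('a \<Rightarrow> ('a list, 'k) tens) poly \<Rightarrow> 'a \<Rightarrow> ('a list, 'k) tens"
  where
  "obstruction_comult s N D =
     (\<Sum>i = 1..N. (tmap s (coeff D i) (tone s) \<circ> coeff D (N + 1 - i))
               - (tmap s (tone s) (coeff D i) \<circ> coeff D (N + 1 - i)))"

definition obstruction_mor ::
  "('k::field \<Rightarrow> 'b::ab_group_add \<Rightarrow> 'b) \<Rightarrow> nat \<Rightarrow> ('a \<Rightarrow> ('a list, 'k) tens) poly \<Rightarrow>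
   ('b \<Rightarrow> ('b list, 'k) tens) poly \<Rightarrow> ('a \<Rightarrow> 'b) poly \<Rightarrow> 'a::ab_group_add \<Rightarrow> ('b list, 'k) tens"
  where
  "obstruction_mor sB N DA DB F =
     (\<Sum>(i, j, k) | i + j + k = N + 1 \<and> i \<le> N \<and> j \<le> N \<and> k \<le> N.
        tmap sB (tone sB \<circ> coeff F j) (tone sB \<circ> coeff F k) \<circ> coeff DA i)
     - (\<Sum>i = 1..N. coeff DB (N + 1 - i) \<circ> coeff F i)"

definition obstruction ::
  "('k::field \<Rightarrow> 'a::ab_group_add \<Rightarrow> 'a) \<Rightarrow> ('k \<Rightarrow> 'b::ab_group_add \<Rightarrow> 'b) \<Rightarrow> nat \<Rightarrow>
   ('a, 'b, 'k) coeff2 poly \<Rightarrow> ('a, 'b, 'k) mor_cochain"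
  where
  "obstruction sA sB N \<Omega> =
     (obstruction_comult sA N (partA \<Omega>),
      obstruction_comult sB N (partB \<Omega>),
      obstruction_mor sB N (partA \<Omega>) (partB \<Omega>) (partF \<Omega>))"

end

theory Submission
  imports Defs
begin

text \<open>
  Both deformation equations are quadratic or cubic in the coefficients, so modulo \<open>t\<^sup>N\<^sup>+\<^sup>2\<close> they
  say that the equations modulo \<open>t\<^sup>N\<^sup>+\<^sup>1\<close> hold and that the two coefficients of \<open>t\<^sup>N\<^sup>+\<^sup>1\<close> agree.  In
  that coefficient the terms involving \<open>\<omega>\<^sub>N\<^sub>+\<^sub>1\<close> contain otherwise only \<open>\<omega>\<^sub>0\<close> and add up to
  \<open>d\<^sub>c \<omega>\<^sub>N\<^sub>+\<^sub>1\<close>, while the remaining ones make up the obstruction.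
\<close>

section \<open>Linear maps on tensor powers\<close>

lemma sum_apply: "(\<Sum>i\<in>I. g i) x = (\<Sum>i\<in>I. g i x)"
  for g :: "'i \<Rightarrow> 'x \<Rightarrow> 'y::comm_monoid_add"
  by (induction I rule: infinite_finite_induct) simp_all

lemma linear_tscale_iff:
  fixes s :: "'k::field \<Rightarrow> 'a::ab_group_add \<Rightarrow> 'a" and g :: "'a \<Rightarrow> ('x, 'k) tens"
  assumes "vector_space s"
  shows "Vector_Spaces.linear s tscale g \<longleftrightarrow>
    (\<forall>a b. g (a + b) = g a + g b) \<and> (\<forall>c a. g (s c a) = tscale c (g a))"
  using assms vector_space_tscale[where ?'k = 'k and ?'x = 'x]
  by (simp add: Vector_Spaces.linear_iff_module_hom module_hom_iff module_iff_vector_space)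

lemma linear_tens_add:
  fixes g h :: "('x, 'k::field) tens \<Rightarrow> ('y, 'k) tens"
  assumes "Vector_Spaces.linear tscale tscale g" "Vector_Spaces.linear tscale tscale h"
  shows "Vector_Spaces.linear tscale tscale (\<lambda>T. g T + h T)"
  using assms
  by (simp add: linear_tscale_iff[OF vector_space_tscale]) (simp add: tscale_def fun_eq_iff algebra_simps)

lemma linear_tens_scale:
  fixes g :: "('x, 'k::field) tens \<Rightarrow> ('y, 'k) tens"
  assumes "Vector_Spaces.linear tscale tscale g"
  shows "Vector_Spaces.linear tscale tscale (\<lambda>T. tscale c (g T))"
  using assms
  by (simp add: linear_tscale_iff[OF vector_space_tscale]) (simp add: tscale_def fun_eq_iff algebra_simps)

lemma linear_tens_zero:
  "Vector_Spaces.linear tscale tscale (\<lambda>T :: ('x, 'k::field) tens. (0 :: ('y, 'k) tens))"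
  by (simp add: linear_tscale_iff[OF vector_space_tscale]) (simp add: tscale_def fun_eq_iff)

lemma linear_eq_on_tensor_power:
  assumes "Vector_Spaces.linear tscale tscale h" "Vector_Spaces.linear tscale tscale h'"
    and "\<And>xs. length xs = n \<Longrightarrow> h (tensor s xs) = h' (tensor s xs)" and "T \<in> tensor_power s n"
  shows "h T = h' T"
  using linear_eq_on_tens_span[OF assms(1,2) _ assms(4)[unfolded tensor_power_def]] assms(3) by blast

text \<open>Every argument that the definition feeds to \<open>\<beta>\<close> has length
  \<open>n\<close>, so values on lists of other lengths cannot matter.\<close>

lemma multilinear_cong:
  assumes "\<And>xs. length xs = n \<Longrightarrow> \<beta> xs = \<gamma> xs"
  shows "multilinear s sU n \<beta> \<longleftrightarrow> multilinear s sU n \<gamma>"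
proof -
  have "(\<lambda>a. \<beta> (xs @ a # ys)) = (\<lambda>a. \<gamma> (xs @ a # ys))" if "length xs + Suc (length ys) = n" for xs ys
    using that assms by (simp add: fun_eq_iff)
  then show ?thesis unfolding multilinear_def by metis
qed

lemma lift_zero: "lift \<beta> 0 = 0"
  by (simp add: lift_def fun_eq_iff)

lemma lift_lift: "lift \<beta> (lift \<gamma> T) = lift (\<lambda>x. lift \<beta> (\<gamma> x)) T"
  by (simp add: lift_def)

text \<open>On a pure tensor both sides are evaluation at \<open>xs\<close> of forms that agree on
  lists of length \<open>n\<close>. For each \<open>\<psi>\<close> these forms are multilinear
  together, and otherwise both evaluations give the default value 0.\<close>

lemma lift_cong:
  assumes "T \<in> tensor_power s n" and "\<And>xs. length xs = n \<Longrightarrow> \<beta> xs = \<gamma> xs"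
  shows "lift \<beta> T = lift \<gamma> T"
proof (rule linear_eq_on_tensor_power[OF linear_lift linear_lift _ assms(1)])
  fix xs :: "'a list" assume "length xs = n"
  then show "lift \<beta> (tensor s xs) = lift \<gamma> (tensor s xs)"
    using assms(2) multilinear_cong[of n "\<lambda>x. \<beta> x \<psi>" "\<lambda>x. \<gamma> x \<psi>" s "(*)" for \<psi>]
    by (simp add: lift_def tensor_def eval_on_def fun_eq_iff)
qed

lemma tensor_in_tensor_power:
  "tensor (s :: 'k::field \<Rightarrow> 'a::ab_group_add \<Rightarrow> 'a) xs \<in> tensor_power s (length xs)"
proof -
  interpret vector_space "tscale :: 'k \<Rightarrow> ('a list, 'k) tens \<Rightarrow> _" by (rule vector_space_tscale)
  show ?thesis unfolding tensor_power_def by (rule span_base) auto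
qed

lemma tone_in_tensor_power: "tone s a \<in> tensor_power s 1"
  using tensor_in_tensor_power[of s "[a]"] by (simp add: tone_def)

lemma zero_in_tensor_power: "0 \<in> tensor_power (s :: 'k::field \<Rightarrow> 'a::ab_group_add \<Rightarrow> 'a) n"
proof -
  interpret vector_space "tscale :: 'k \<Rightarrow> ('a list, 'k) tens \<Rightarrow> _" by (rule vector_space_tscale)
  show ?thesis unfolding tensor_power_def by (rule span_zero)
qed

text \<open>An arbitrary functional may send the zero form to a nonzero value; elements of a tensor
  power do not, since pure tensors do not.\<close>

lemma lift_zero_fun:
  assumes "T \<in> tensor_power s n"
  shows "lift (\<lambda>_. 0) T = 0"
  by (rule linear_eq_on_tensor_power[OF linear_lift linear_tens_zero _ assms])
    (simp add: lift_def tensor_def eval_on_def fun_eq_iff)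

text \<open>A tensor is additive and homogeneous only on multilinear forms, so linearity in
  \<open>a\<close> is not visible from the definition of \<open>lift\<close>. Both sides of each
  equation are linear in \<open>T\<close>, which reduces the claim to pure tensors, where
  \<open>lift\<close> is plain evaluation.\<close>

lemma linear_lift_param:
  fixes s :: "'k::field \<Rightarrow> 'a::ab_group_add \<Rightarrow> 'a" and t :: "'k \<Rightarrow> 'b::ab_group_add \<Rightarrow> 'b"
    and \<gamma> :: "'a \<Rightarrow> 'b list \<Rightarrow> ('y, 'k) tens"
  assumes "vector_space s" and T: "T \<in> tensor_power t n"
    and lin: "\<And>xs. length xs = n \<Longrightarrow> Vector_Spaces.linear s tscale (\<lambda>a. \<gamma> a xs)"
    and mult: "\<And>a. multilinear t tscale n (\<gamma> a)"
  shows "Vector_Spaces.linear s tscale (\<lambda>a. lift (\<gamma> a) T)"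
  unfolding linear_tscale_iff[OF assms(1)]
proof (intro conjI allI)
  show "lift (\<gamma> (a + b)) T = lift (\<gamma> a) T + lift (\<gamma> b) T" for a b
    by (rule linear_eq_on_tensor_power[OF linear_lift linear_tens_add[OF linear_lift linear_lift] _ T])
      (use mult lin in \<open>simp add: lift_tensor linear_tscale_iff[OF assms(1)] plus_fun_def\<close>)
  show "lift (\<gamma> (s c a)) T = tscale c (lift (\<gamma> a) T)" for a c
    by (rule linear_eq_on_tensor_power[OF linear_lift linear_tens_scale[OF linear_lift] _ T])
      (use mult lin in \<open>simp add: lift_tensor linear_tscale_iff[OF assms(1)]\<close>)
qed

lemma multilinear_tensor_append_left:
  assumes "vector_space s"
  shows "multilinear s tscale n (\<lambda>ys. tensor s (xs @ ys))"
  using multilinear_tensor[OF assms, of "length xs + n", unfolded multilinear_def, rule_format, of "xs @ _"]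
  unfolding multilinear_def by simp

lemma multilinear_tensor_append_right:
  assumes "vector_space s"
  shows "multilinear s tscale n (\<lambda>xs. tensor s (xs @ ys))"
  using multilinear_tensor[OF assms, of "n + length ys", unfolded multilinear_def, rule_format, of _ "_ @ ys"]
  unfolding multilinear_def by simp

lemma lift_tensor_self:
  fixes s :: "'k::field \<Rightarrow> 'a::ab_group_add \<Rightarrow> 'a"
  assumes "vector_space s" and "T \<in> tensor_power s n"
  shows "lift (tensor s) T = T"
proof (rule linear_eq_on_tensor_power[OF linear_lift _ _ assms(2)])
  show "Vector_Spaces.linear tscale tscale (\<lambda>T :: ('a list, 'k) tens. T)"
    by (simp add: linear_tscale_iff[OF vector_space_tscale])
qed (simp add: lift_tensor[OF multilinear_tensor[OF assms(1)]])

section \<open>The product of tensors\<close>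

lemma linear_tmult_left: "Vector_Spaces.linear tscale tscale (\<lambda>T. tmult s T U)"
  unfolding tmult_def by (rule linear_lift)

lemma tmult_zero_left: "tmult s 0 U = 0"
  by (simp add: tmult_def lift_zero)

lemma tmult_zero_right:
  assumes "T \<in> tensor_power s n"
  shows "tmult s T 0 = 0"
  using lift_zero_fun[OF assms] by (simp add: tmult_def lift_zero)

text \<open>The outer \<open>lift\<close> collapses once the inner one is multilinear in
  \<open>xs\<close>; this is where \<open>U\<close> has to lie in a tensor power.\<close>

lemma tmult_tensor_left:
  fixes s :: "'k::field \<Rightarrow> 'a::ab_group_add \<Rightarrow> 'a"
  assumes "vector_space s" and "U \<in> tensor_power s n"
  shows "tmult s (tensor s xs) U = lift (\<lambda>ys. tensor s (xs @ ys)) U"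
  unfolding tmult_def
proof (rule lift_tensor)
  show "multilinear s tscale (length xs) (\<lambda>xs. lift (\<lambda>ys. tensor s (xs @ ys)) U)"
    unfolding multilinear_def
  proof (intro allI impI linear_lift_param[OF assms])
    fix us vs ys :: "'a list"
    show "Vector_Spaces.linear s tscale (\<lambda>a. tensor s ((us @ a # vs) @ ys))"
      using multilinear_tensor[OF assms(1), of "length us + Suc (length (vs @ ys))"]
      by (simp add: multilinear_def)
    show "multilinear s tscale n (\<lambda>ys. tensor s ((us @ a # vs) @ ys))" for a
      by (rule multilinear_tensor_append_left[OF assms(1)])
  qed
qed

lemma tmult_tensor_right:
  assumes "vector_space s"
  shows "tmult s T (tensor s ys) = lift (\<lambda>xs. tensor s (xs @ ys)) T"
  unfolding tmult_def by (simp add: lift_tensor[OF multilinear_tensor_append_left[OF assms]])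

lemma tmult_tensor_Nil_right:
  assumes "vector_space s" and "T \<in> tensor_power s n"
  shows "tmult s T (tensor s []) = T"
  using tmult_tensor_right[OF assms(1), of T "[]"] lift_tensor_self[OF assms] by simp

text \<open>A product is a \<open>lift\<close> of pure tensors, and \<open>lift (tensor s)\<close>
  fixes each of these. Stating the unit law for products allows its use without tracking the
  degree.\<close>

lemma tmult_tensor_Nil_left:
  assumes "vector_space s"
  shows "tmult s (tensor s []) (tmult s T U) = tmult s T U"
proof -
  have "tmult s (tensor s []) (tmult s T U) = lift (\<lambda>xs. lift (\<lambda>ys. tensor s (xs @ ys)) (tmult s T U)) (tensor s [])"
    by (simp add: tmult_def)
  also have "\<dots> = lift (tensor s) (tmult s T U)"
    \<comment> \<open>For the empty list multilinearity is vacuous, so \<open>lift\<close> evaluates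
      at \<open>[]\<close>.\<close>
    by (subst lift_tensor) (simp_all add: multilinear_def)
  also have "\<dots> = tmult s T U"
    by (simp add: tmult_def lift_lift lift_tensor[OF multilinear_tensor[OF assms]])
  finally show ?thesis .
qed

section \<open>Vanishing of \<open>tmap\<close> on zero maps and zero tensors\<close>

lemma tmap_zero_left:
  assumes "T \<in> tensor_power s n"
  shows "tmap s' 0 \<tau> T = 0"
  using lift_zero_fun[OF assms] by (simp add: tmap_def tmult_zero_left)

lemma tmap_zero_right:
  assumes "T \<in> tensor_power s n" and "\<And>a. \<sigma> a \<in> tensor_power s' p"
  shows "tmap s' \<sigma> 0 T = 0"
  using lift_zero_fun[OF assms(1)] by (simp add: tmap_def tmult_zero_right[OF assms(2)])

lemma tmap_zero: "tmap s \<sigma> \<tau> 0 = 0"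
  by (simp add: tmap_def lift_zero)

lemma tone_comp_zero:
  assumes "vector_space s"
  shows "tone s \<circ> 0 = 0"
proof -
  interpret Vector_Spaces.linear s tscale "tone s" by (rule linear_tone[OF assms])
  show ?thesis by (simp add: fun_eq_iff zero)
qed

section \<open>The coboundary in low degrees\<close>

lemma zero_in_tensor_hom: "vector_space s \<Longrightarrow> 0 \<in> tensor_hom s s' n"
  by (auto simp: tensor_hom_def zero_in_tensor_power linear_tscale_iff)
    (simp add: tscale_def fun_eq_iff)

lemma tensor_homD:
  assumes "\<sigma> \<in> tensor_hom s s' n"
  shows "Vector_Spaces.linear s tscale \<sigma>" "\<sigma> a \<in> tensor_power s' n"
  using assms by (auto simp: tensor_hom_def)

lemma tensor_hom_zero:
  assumes "vector_space s" "\<sigma> \<in> tensor_hom s s' n"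
  shows "\<sigma> 0 = 0"
proof -
  interpret Vector_Spaces.linear s tscale \<sigma> by (rule tensor_homD[OF assms(2)])
  show ?thesis by (rule zero)
qed

text \<open>This removes the binary tensor product from the coboundary: the integrand is bilinear,
  so the universal property evaluates it on the pure tensors produced by the coaction, and what
  remains is a \<open>tmap\<close> on \<open>A \<otimes> A\<close>.\<close>

lemma lift_left_coaction:
  fixes sA :: "'k::field \<Rightarrow> 'a::ab_group_add \<Rightarrow> 'a" and sB :: "'k \<Rightarrow> 'b::ab_group_add \<Rightarrow> 'b"
  assumes B: "vector_space sB" and \<sigma>: "\<sigma> \<in> tensor_hom sA sB n"
  shows "lift (\<lambda>(b, a). tmult sB (tone sB b) (\<sigma> a)) (left_coaction sA sB \<Delta> f x) =
    tmap sB (tone sB \<circ> f) \<sigma> (\<Delta> x)"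
proof -
  have "bilinear_map sB sA tscale (\<lambda>(b, a). tmult sB (tone sB b) (\<sigma> a))"
    unfolding bilinear_map_def
  proof (intro conjI allI)
    show "Vector_Spaces.linear sB tscale (\<lambda>v. case (v, w) of (b, a) \<Rightarrow> tmult sB (tone sB b) (\<sigma> a))" for w
      using linear_comp[OF linear_tone[OF B] linear_tmult_left] by simp
    show "Vector_Spaces.linear sA tscale (\<lambda>w. case (v, w) of (b, a) \<Rightarrow> tmult sB (tone sB b) (\<sigma> a))" for v
      using linear_comp[OF tensor_homD(1)[OF \<sigma>] linear_lift]
      by (simp add: tone_def tmult_tensor_left[OF B tensor_homD(2)[OF \<sigma>]])
  qed
  then show ?thesis
    by (simp add: left_coaction_def tmap_def lift_lift lift_tensor2)
qed

lemma lift_right_coaction: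
  fixes sA :: "'k::field \<Rightarrow> 'a::ab_group_add \<Rightarrow> 'a" and sB :: "'k \<Rightarrow> 'b::ab_group_add \<Rightarrow> 'b"
  assumes B: "vector_space sB" and \<sigma>: "\<sigma> \<in> tensor_hom sA sB n"
  shows "lift (\<lambda>(a, b). tmult sB (\<sigma> a) (tone sB b)) (right_coaction sA sB \<Delta> f x) =
    tmap sB \<sigma> (tone sB \<circ> f) (\<Delta> x)"
proof -
  have "bilinear_map sA sB tscale (\<lambda>(a, b). tmult sB (\<sigma> a) (tone sB b))"
    unfolding bilinear_map_def
  proof (intro conjI allI)
    show "Vector_Spaces.linear sA tscale (\<lambda>v. case (v, w) of (a, b) \<Rightarrow> tmult sB (\<sigma> a) (tone sB b))" for w
      using linear_comp[OF tensor_homD(1)[OF \<sigma>] linear_tmult_left] by simp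
    \<comment> \<open>The product is a \<open>lift\<close> in its left factor, so linearity in the
      right factor is linearity in a parameter.\<close>
    have "Vector_Spaces.linear sB tscale (\<lambda>b. lift (\<lambda>xs. tensor sB (xs @ [b])) (\<sigma> v))" for v
    proof (rule linear_lift_param[OF B tensor_homD(2)[OF \<sigma>]])
      show "Vector_Spaces.linear sB tscale (\<lambda>b. tensor sB (xs @ [b]))" for xs
        using multilinear_tensor[OF B, of "length xs + Suc (length [])"]
        unfolding multilinear_def by blast
    qed (rule multilinear_tensor_append_right[OF B])
    then show "Vector_Spaces.linear sB tscale (\<lambda>w. case (v, w) of (a, b) \<Rightarrow> tmult sB (\<sigma> a) (tone sB b))" for v
      by (simp add: tone_def tmult_tensor_right[OF B])
  qed
  then show ?thesis
    by (simp add: right_coaction_def tmap_def lift_lift lift_tensor2)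
qed

lemma comult_at_1_of_2:
  assumes "vector_space s" and "T \<in> tensor_power s 2"
  shows "comult_at s \<Delta> 1 T = tmap s \<Delta> (tone s) T"
  unfolding comult_at_def tmap_def
  by (rule lift_cong[OF assms(2)])
    (auto simp: tmult_tensor_Nil_left[OF assms(1)] tone_def numeral_2_eq_2 length_Suc_conv)

lemma comult_at_2_of_2:
  assumes "vector_space s" and "\<Delta> \<in> tensor_hom s s 2" and "T \<in> tensor_power s 2"
  shows "comult_at s \<Delta> 2 T = tmap s (tone s) \<Delta> T"
  unfolding comult_at_def tmap_def
  by (rule lift_cong[OF assms(3)])
    (auto simp: tmult_tensor_Nil_right[OF assms(1) tensor_homD(2)[OF assms(2)]] tone_def
      numeral_2_eq_2 length_Suc_conv)

lemma comult_at_tone: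
  assumes "vector_space s" and "\<Delta> \<in> tensor_hom s s 2"
  shows "comult_at s \<Delta> 1 (tone s a) = \<Delta> a"
proof -
  have "comult_at s \<Delta> 1 (tone s a) = lift (\<lambda>xs. \<Delta> (xs ! 0)) (tone s a)"
    unfolding comult_at_def
    \<comment> \<open>The empty tensors on both sides of \<open>\<Delta>\<close> disappear. The last
      rule writes a value of \<open>\<Delta>\<close> as a product with the empty tensor on the
      right, so that the left unit law for products applies to it.\<close>
    by (rule lift_cong[OF tone_in_tensor_power])
      (auto simp: tmult_tensor_Nil_right[OF assms(1) tensor_homD(2)[OF assms(2)]]
        tmult_tensor_Nil_left[OF assms(1)] length_Suc_conv
        tmult_tensor_Nil_left[OF assms(1), of "\<Delta> _" "tensor s []",
          unfolded tmult_tensor_Nil_right[OF assms(1) tensor_homD(2)[OF assms(2)]]])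
  also have "\<dots> = \<Delta> a"
    unfolding tone_def
    by (subst lift_tensor) (use tensor_homD(1)[OF assms(2)] in \<open>auto simp: multilinear_def\<close>)
  finally show ?thesis .
qed

lemma tscale_one: "tscale 1 T = T" and tscale_minus_one: "tscale (-1) T = - T"
  by (simp_all add: tscale_def fun_eq_iff)

text \<open>In degree 2 the signs of the four terms are +, -, +, -; the coactions for
  \<open>f = id\<close> become \<open>tmap\<close> terms on \<open>\<Delta> a\<close>.\<close>

lemma coboundary_self_2:
  assumes "vector_space s" and "\<Delta> \<in> tensor_hom s s 2" and "\<sigma> \<in> tensor_hom s s 2"
  shows "coboundary_self s \<Delta> 2 \<sigma> a =
    tmap s (tone s) \<sigma> (\<Delta> a) - tmap s \<Delta> (tone s) (\<sigma> a) + tmap s (tone s) \<Delta> (\<sigma> a)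
    - tmap s \<sigma> (tone s) (\<Delta> a)"
  using comult_at_1_of_2[OF assms(1) tensor_homD(2)[OF assms(3)], of \<Delta> a]
    comult_at_2_of_2[OF assms(1,2) tensor_homD(2)[OF assms(3)], of a]
    lift_left_coaction[OF assms(1,3), of \<Delta> id a] lift_right_coaction[OF assms(1,3), of \<Delta> id a]
  by (simp add: coboundary_self_def coboundary_def numeral_2_eq_2 tscale_one tscale_minus_one)

lemma coboundary_along_1:
  assumes B: "vector_space sB" and E: "\<Delta>B \<in> tensor_hom sB sB 2"
    and g: "tone sB \<circ> g \<in> tensor_hom sA sB 1"
  shows "coboundary_along sA \<Delta>A sB \<Delta>B f 1 (tone sB \<circ> g) a =
    tmap sB (tone sB \<circ> f) (tone sB \<circ> g) (\<Delta>A a) - \<Delta>B (g a)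
    + tmap sB (tone sB \<circ> g) (tone sB \<circ> f) (\<Delta>A a)"
  using lift_left_coaction[OF B g, of \<Delta>A f a] lift_right_coaction[OF B g, of \<Delta>A f a]
    comult_at_tone[OF B E, of "g a"]
  by (simp add: coboundary_along_def coboundary_def tscale_one tscale_minus_one)

lemma tpower_map_2:
  assumes "vector_space sB" and "T \<in> tensor_power sA 2"
  shows "tpower_map sB f T = tmap sB (tone sB \<circ> f) (tone sB \<circ> f) T"
  unfolding tpower_map_def tmap_def
  by (rule lift_cong[OF assms(2)])
    (auto simp: tone_def tmult_tensor[OF assms(1)] numeral_2_eq_2 length_Suc_conv)

section \<open>Coefficients of products of polynomials\<close>

text \<open>The additive map \<open>l\<close> is evaluation at a tensor in the applications: \<open>tmap s 0 \<tau>\<close> is not the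
  zero function, it only vanishes on tensor powers.\<close>

lemma coeff_poly_ext:
  assumes add: "\<And>x y. l (x + y) = l x + l y" and zero: "l 0 = 0"
    and left: "\<And>j. l (b 0 (coeff Q j)) = 0" and right: "\<And>i. l (b (coeff P i) 0) = 0"
  shows "l (coeff (poly_ext b P Q) n) = (\<Sum>i\<le>n. l (b (coeff P i) (coeff Q (n - i))))"
proof -
  have l_sum: "l (sum g I) = (\<Sum>i\<in>I. l (g i))" for g :: "nat \<Rightarrow> _" and I
    by (induction I rule: infinite_finite_induct) (simp_all add: add zero)
  let ?t = "\<lambda>i j. l (b (coeff P i) (coeff Q j))"
  have "l (coeff (poly_ext b P Q) n) = 
      (\<Sum>i\<le>degree P. \<Sum>j\<le>degree Q. if i + j = n then ?t i j else 0)"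
    unfolding poly_ext_def coeff_sum l_sum by (intro sum.cong refl) (simp add: zero)
  also have "\<dots> = (\<Sum>i\<le>degree P. if i \<le> n then ?t i (n - i) else 0)"
  proof (intro sum.cong refl)
    fix i
    have "(\<Sum>j\<le>degree Q. if i + j = n then ?t i j else 0) =
        (\<Sum>j\<le>degree Q. if i \<le> n \<and> j = n - i then ?t i j else 0)"
      by (intro sum.cong refl if_cong) auto
    also have "\<dots> = (if i \<le> n then ?t i (n - i) else 0)"
      \<comment> \<open>If \<open>n - i\<close> exceeds the degree of \<open>Q\<close>, no index
        \<open>j\<close> matches, and \<open>?t i (n - i)\<close> is zero by
        \<open>right\<close>.\<close>
      using right coeff_eq_0[of Q] by (cases "i \<le> n") (auto simp: sum.delta not_le)
    finally show "(\<Sum>j\<le>degree Q. if i + j = n then ?t i j else 0) = \<dots>" .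
  qed
  also have "\<dots> = (\<Sum>i\<in>{..degree P} \<inter> {..n}. ?t i (n - i))"
    by (subst sum.inter_restrict) auto
  also have "\<dots> = (\<Sum>i\<le>n. ?t i (n - i))"
    \<comment> \<open>Indices beyond the degree of \<open>P\<close> contribute zero by
      \<open>left\<close>, so the range can be extended to all \<open>i \<le> n\<close>.\<close>
    by (rule sum.mono_neutral_left) (auto, metis left coeff_eq_0 not_le)
  finally show ?thesis .
qed

lemma coeff_poly_ext_comp:
  assumes "\<And>i. coeff P i 0 = 0"
  shows "coeff (poly_ext (\<circ>) P Q) n a = (\<Sum>i\<le>n. coeff P i (coeff Q (n - i) a))"
  using coeff_poly_ext[where l = "\<lambda>X. X a" and b = "(\<circ>)" and P = P and Q = Q] assms by simp

lemma coeff_poly_ext_tmap: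
  assumes "T \<in> tensor_power s n" and "\<And>i a. coeff P i a \<in> tensor_power s' p"
  shows "coeff (poly_ext (tmap s') P Q) m T = (\<Sum>i\<le>m. tmap s' (coeff P i) (coeff Q (m - i)) T)"
  by (rule coeff_poly_ext[where l = "\<lambda>X. X T"])
    (simp_all add: tmap_zero_left[OF assms(1)] tmap_zero_right[OF assms(1) assms(2)])

text \<open>Each \<open>tmap\<close> is a \<open>lift\<close> and hence vanishes at the zero tensor.
  This supplies the condition under which \<open>coeff_poly_ext_comp\<close> expands a
  composition.\<close>

lemma poly_ext_tmap_zero: "coeff (poly_ext (tmap s) P Q) n 0 = 0"
  by (simp add: poly_ext_def coeff_sum sum_apply tmap_zero if_distribR cong: if_cong)

lemma coeff_poly_ext_tmap_tone_left:
  fixes s :: "'k::field \<Rightarrow> 'a::ab_group_add \<Rightarrow> 'a"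
  assumes "T \<in> tensor_power s n"
  shows "coeff (poly_ext (tmap s) [:tone s:] D) m T = tmap s (tone s) (coeff D m) T"
proof -
  have "coeff (poly_ext (tmap s) [:tone s:] D) m T =
      (\<Sum>i\<le>m. tmap s (coeff [:tone s:] i) (coeff D (m - i)) T)"
    by (rule coeff_poly_ext_tmap[OF assms, of _ s 1])
      (auto simp: coeff_pCons tone_in_tensor_power[simplified] zero_in_tensor_power split: nat.split)
  also have "\<dots> = (\<Sum>i\<in>{0}. tmap s (coeff [:tone s:] i) (coeff D (m - i)) T)"
    by (rule sum.mono_neutral_right)
      (auto simp: coeff_pCons tmap_zero_left[OF assms] split: nat.split)
  finally show ?thesis by simp
qed

lemma coeff_poly_ext_tmap_tone_right:
  fixes s :: "'k::field \<Rightarrow> 'a::ab_group_add \<Rightarrow> 'a"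
  assumes "T \<in> tensor_power s n" and "\<And>i a. coeff D i a \<in> tensor_power s p"
  shows "coeff (poly_ext (tmap s) D [:tone s:]) m T = tmap s (coeff D m) (tone s) T"
proof -
  have "coeff (poly_ext (tmap s) D [:tone s:]) m T =
      (\<Sum>i\<le>m. tmap s (coeff D i) (coeff [:tone s:] (m - i)) T)"
    by (rule coeff_poly_ext_tmap[OF assms])
  also have "\<dots> = (\<Sum>i\<in>{m}. tmap s (coeff D i) (coeff [:tone s:] (m - i)) T)"
    by (rule sum.mono_neutral_right)
      (auto simp: coeff_pCons tmap_zero_right[OF assms] split: nat.split)
  finally show ?thesis by simp
qed

lemma coeff_poly_ext_tmap_tone:
  assumes "vector_space s'" and T: "T \<in> tensor_power s n"
  shows "coeff (poly_ext (\<lambda>g h. tmap s' (tone s' \<circ> g) (tone s' \<circ> h)) P Q) m T =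
    (\<Sum>i\<le>m. tmap s' (tone s' \<circ> coeff P i) (tone s' \<circ> coeff Q (m - i)) T)"
proof -
  have "tmap s' (tone s' \<circ> g) 0 T = 0" for g
    by (rule tmap_zero_right[OF T, of _ s' 1]) (simp add: tone_in_tensor_power[simplified])
  then show ?thesis
    by (intro coeff_poly_ext[where l = "\<lambda>X. X T"])
      (simp_all add: tmap_zero_left[OF T] tone_comp_zero[OF assms(1)])
qed

section \<open>The obstruction as the coefficient of degree \<open>N + 1\<close>\<close>

text \<open>The two end terms are the ones in which a coefficient of top index occurs; the middle
  range is that of the obstruction.\<close>

lemma sum_atMost_Suc_split: "(\<Sum>i\<le>Suc n. g i) = g 0 + (\<Sum>i=1..n. g i) + g (Suc n)"
  for g :: "nat \<Rightarrow> 'z::comm_monoid_add"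
  by (simp add: atMost_atLeast0 sum.atLeast_Suc_atMost)

section \<open>The coassociativity equation\<close>

lemma coassoc_upto_iff:
  assumes D: "\<And>n. coeff D n \<in> tensor_hom s s 2"
  shows "coassoc_upto s N D \<longleftrightarrow> (\<forall>n\<le>N. \<forall>a.
    (\<Sum>i\<le>n. tmap s (tone s) (coeff D i) (coeff D (n - i) a)) =
    (\<Sum>i\<le>n. tmap s (coeff D i) (tone s) (coeff D (n - i) a)))"
  unfolding coassoc_upto_def cong_upto_def fun_eq_iff[of "coeff _ _"]
  by (simp add: coeff_poly_ext_comp poly_ext_tmap_zero
      coeff_poly_ext_tmap_tone_left[OF tensor_homD(2)[OF D]]
      coeff_poly_ext_tmap_tone_right[OF tensor_homD(2)[OF D] tensor_homD(2)[OF D]])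

lemma coassoc_upto_Suc:
  fixes s :: "'k::field \<Rightarrow> 'a::ab_group_add \<Rightarrow> 'a"
  assumes s: "vector_space s" and D: "\<And>n. coeff D n \<in> tensor_hom s s 2"
  shows "coassoc_upto s (Suc N) D \<longleftrightarrow> coassoc_upto s N D \<and>
    obstruction_comult s N D = coboundary_self s (coeff D 0) 2 (coeff D (Suc N))"
proof -
  \<comment> \<open>Here \<open>x\<close>, \<open>x'\<close> come from index 0 and \<open>z\<close>,
    \<open>z'\<close> from index \<open>Suc N\<close>, while \<open>l\<close>, \<open>r\<close> are
    the middle sums. Then \<open>r - l\<close> is the obstruction and the right side is the
    coboundary of the top coefficient.\<close>
  have eq: "x + l + z = x' + r + z' \<longleftrightarrow> r - l = z - x' + x - z'" for x l z x' r z'  :: "('a list, 'k) tens"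
    by (auto simp: algebra_simps)
  have "(\<Sum>i\<le>Suc N. tmap s (tone s) (coeff D i) (coeff D (Suc N - i) a)) =
      (\<Sum>i\<le>Suc N. tmap s (coeff D i) (tone s) (coeff D (Suc N - i) a)) \<longleftrightarrow>
      obstruction_comult s N D a = coboundary_self s (coeff D 0) 2 (coeff D (Suc N)) a" for a
  proof -
    have "obstruction_comult s N D a = (\<Sum>i=1..N. tmap s (coeff D i) (tone s) (coeff D (Suc N - i) a))
        - (\<Sum>i=1..N. tmap s (tone s) (coeff D i) (coeff D (Suc N - i) a))"
      by (simp add: obstruction_comult_def sum_apply[of _ _ a] sum_subtractf)
    then show ?thesis
      unfolding sum_atMost_Suc_split eq coboundary_self_2[OF s D D] by simp
  qed
  then show ?thesis
    unfolding coassoc_upto_iff[OF D] fun_eq_iff[of "obstruction_comult _ _ _"]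
    by (auto simp only: le_Suc_eq)
qed

section \<open>The morphism equation\<close>

lemma morphism_upto_iff:
  assumes B: "vector_space sB" and D: "\<And>n. coeff DA n \<in> tensor_hom sA sA 2"
    and E: "\<And>n. coeff DB n \<in> tensor_hom sB sB 2"
  shows "morphism_upto sB N DA DB F \<longleftrightarrow> (\<forall>n\<le>N. \<forall>a.
    (\<Sum>i\<le>n. coeff DB i (coeff F (n - i) a)) =
    (\<Sum>i\<le>n. \<Sum>j\<le>i. tmap sB (tone sB \<circ> coeff F j) (tone sB \<circ> coeff F (i - j)) (coeff DA (n - i) a)))"
proof -
  have "coeff (poly_ext (\<lambda>g h. tmap sB (tone sB \<circ> g) (tone sB \<circ> h)) F F) i 0 = 0" for i
    by (simp add: coeff_poly_ext_tmap_tone[OF B zero_in_tensor_power] tmap_zero)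
  then show ?thesis
    unfolding morphism_upto_def cong_upto_def fun_eq_iff[of "coeff _ _"]
    by (simp add: coeff_poly_ext_comp tensor_hom_zero[OF B E]
        coeff_poly_ext_tmap_tone[OF B tensor_homD(2)[OF D]])
qed

text \<open>The double sum runs over all triples of total \<open>Suc N\<close>, with the outer index
  equal to \<open>j + k\<close>. If one entry is \<open>Suc N\<close>, the other two are 0, which
  gives three exceptional triples.\<close>

lemma sum_triples_split:
  fixes g :: "nat \<Rightarrow> nat \<Rightarrow> nat \<Rightarrow> 'z::comm_monoid_add"
  shows "(\<Sum>i\<le>Suc N. \<Sum>j\<le>i. g (Suc N - i) j (i - j)) =
    g (Suc N) 0 0 + g 0 (Suc N) 0 + g 0 0 (Suc N) +
    (\<Sum>(i, j, k) | i + j + k = Suc N \<and> i \<le> N \<and> j \<le> N \<and> k \<le> N. g i j k)"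
proof -
  let ?I = "{(i, j, k). i + j + k = Suc N \<and> i \<le> N \<and> j \<le> N \<and> k \<le> N}"
  let ?E = "{(Suc N, 0, 0), (0, Suc N, 0), (0, 0, Suc N)}"
  have "(\<Sum>i\<le>Suc N. \<Sum>j\<le>i. g (Suc N - i) j (i - j)) =
      (\<Sum>(i, j)\<in>(SIGMA i:{..Suc N}. {..i}). g (Suc N - i) j (i - j))"
    by (simp add: sum.Sigma del: sum.atMost_Suc)
  also have "\<dots> = (\<Sum>(i, j, k)\<in>?E \<union> ?I. g i j k)"
    by (rule sum.reindex_bij_witness[where i = "\<lambda>(i, j, k). (j + k, j)" and j = "\<lambda>(i, j). (Suc N - i, j, i - j)"])
      auto
  also have "\<dots> = (\<Sum>(i, j, k)\<in>?E. g i j k) + (\<Sum>(i, j, k)\<in>?I. g i j k)"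
    by (rule sum.union_disjoint)
      (auto intro: finite_subset[of _ "{..N} \<times> {..N} \<times> {..N}"])
  finally show ?thesis by (simp add: add.assoc)
qed

lemma morphism_upto_Suc:
  fixes sA :: "'k::field \<Rightarrow> 'a::ab_group_add \<Rightarrow> 'a" and sB :: "'k \<Rightarrow> 'b::ab_group_add \<Rightarrow> 'b"
  assumes B: "vector_space sB"
    and D: "\<And>n. coeff DA n \<in> tensor_hom sA sA 2" and E: "\<And>n. coeff DB n \<in> tensor_hom sB sB 2"
    and F: "\<And>n. tone sB \<circ> coeff F n \<in> tensor_hom sA sB 1"
  shows "morphism_upto sB (Suc N) DA DB F \<longleftrightarrow> morphism_upto sB N DA DB F \<and>
    obstruction_mor sB N DA DB F =
      (coeff DB (Suc N) \<circ> coeff F 0) - (tpower_map sB (coeff F 0) \<circ> coeff DA (Suc N))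
      - coboundary_along sA (coeff DA 0) sB (coeff DB 0) (coeff F 0) 1 (tone sB \<circ> coeff F (Suc N))"
    (is "_ \<longleftrightarrow> _ \<and> ?ob = ?cob")
proof -
  \<comment> \<open>The left side is split by the index of \<open>DB\<close>. On the right,
    \<open>u\<close>, \<open>v\<close>, \<open>w\<close> belong to the triples with top index in
    \<open>DA\<close>, in the first and in the second factor \<open>F\<close>. The bracket is the
    coboundary of the top coefficient of \<open>F\<close>.\<close>
  have eq: "x + l + z = u + v + w + r \<longleftrightarrow> r - l = z - u - (w - x + v)"
    for x l z u v w r :: "('b list, 'k) tens"
    by (auto simp: algebra_simps)
  have "(\<Sum>i\<le>Suc N. coeff DB i (coeff F (Suc N - i) a)) =
      (\<Sum>i\<le>Suc N. \<Sum>j\<le>i. tmap sB (tone sB \<circ> coeff F j) (tone sB \<circ> coeff F (i - j)) (coeff DA (Suc N - i) a))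
      \<longleftrightarrow> ?ob a = ?cob a" for a
  proof -
    \<comment> \<open>The composition is expanded by the index of \<open>DB\<close>, the obstruction
      by that of \<open>F\<close>; the two are exchanged by reversing the range.\<close>
    have rev: "(\<Sum>i=1..N. coeff DB i (coeff F (Suc N - i) a)) =
        (\<Sum>i=1..N. coeff DB (Suc N - i) (coeff F i a))"
      by (rule sum.reindex_bij_witness[where i = "\<lambda>i. Suc N - i" and j = "\<lambda>i. Suc N - i"]) auto
    have ob: "?ob a = (\<Sum>(i, j, k) | i + j + k = Suc N \<and> i \<le> N \<and> j \<le> N \<and> k \<le> N.
        tmap sB (tone sB \<circ> coeff F j) (tone sB \<circ> coeff F k) (coeff DA i a))
        - (\<Sum>i=1..N. coeff DB (Suc N - i) (coeff F i a))"
      by (simp add: obstruction_mor_def sum_apply case_prod_beta)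
    have cob: "?cob a = coeff DB (Suc N) (coeff F 0 a)
        - tmap sB (tone sB \<circ> coeff F 0) (tone sB \<circ> coeff F 0) (coeff DA (Suc N) a)
        - (tmap sB (tone sB \<circ> coeff F 0) (tone sB \<circ> coeff F (Suc N)) (coeff DA 0 a)
           - coeff DB 0 (coeff F (Suc N) a)
           + tmap sB (tone sB \<circ> coeff F (Suc N)) (tone sB \<circ> coeff F 0) (coeff DA 0 a))"
      by (simp only: minus_apply o_apply tpower_map_2[OF B tensor_homD(2)[OF D]]
          coboundary_along_1[OF B E F])
    show ?thesis
      unfolding sum_triples_split[where g = "\<lambda>i j k. tmap sB (tone sB \<circ> coeff F j) (tone sB \<circ> coeff F k) (coeff DA i a)"]
        sum_atMost_Suc_split rev ob cob eq by simp
  qed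
  then show ?thesis
    unfolding morphism_upto_iff[OF B D E] fun_eq_iff[of ?ob]
    by (auto simp only: le_Suc_eq)
qed

section \<open>Extending a deformation by one order\<close>

lemma as_cochain_in_mor_cochains_2:
  "as_cochain sB \<omega> \<in> mor_cochains sA sB 2 \<longleftrightarrow> fst \<omega> \<in> tensor_hom sA sA 2 \<and>
    fst (snd \<omega>) \<in> tensor_hom sB sB 2 \<and> tone sB \<circ> snd (snd \<omega>) \<in> tensor_hom sA sB 1"
  by (cases \<omega>) (simp add: mor_cochains_def cochains_def)

section \<open>Dependence on the coefficients up to order \<open>N\<close> only\<close>

lemma coassoc_upto_cong:
  assumes "\<And>n. coeff D n \<in> tensor_hom s s 2" "\<And>n. coeff D' n \<in> tensor_hom s s 2"
    and "\<And>n. n \<le> N \<Longrightarrow> coeff D' n = coeff D n"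
  shows "coassoc_upto s N D' \<longleftrightarrow> coassoc_upto s N D"
  unfolding coassoc_upto_iff[OF assms(1)] coassoc_upto_iff[OF assms(2)]
  using assms(3) by (simp cong: sum.cong_simp)

lemma morphism_upto_cong:
  assumes "vector_space sB"
    and "\<And>n. coeff DA n \<in> tensor_hom sA sA 2" "\<And>n. coeff DB n \<in> tensor_hom sB sB 2"
    and "\<And>n. coeff DA' n \<in> tensor_hom sA sA 2" "\<And>n. coeff DB' n \<in> tensor_hom sB sB 2"
    and "\<And>n. n \<le> N \<Longrightarrow> coeff DA' n = coeff DA n" "\<And>n. n \<le> N \<Longrightarrow> coeff DB' n = coeff DB n"
    and "\<And>n. n \<le> N \<Longrightarrow> coeff F' n = coeff F n"
  shows "morphism_upto sB N DA' DB' F' \<longleftrightarrow> morphism_upto sB N DA DB F"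
  unfolding morphism_upto_iff[OF assms(1-3)] morphism_upto_iff[OF assms(1,4,5)]
  using assms(6-8) by (simp cong: sum.cong_simp)

text \<open>For \<open>i\<close> between 1 and \<open>N\<close> the complementary index
  \<open>N + 1 - i\<close> also lies in this range. Hence the obstruction does not see the added
  coefficient.\<close>

lemma obstruction_comult_cong:
  assumes "\<And>n. n \<le> N \<Longrightarrow> coeff D' n = coeff D n"
  shows "obstruction_comult s N D' = obstruction_comult s N D"
  unfolding obstruction_comult_def
proof (intro sum.cong refl)
  fix i assume "i \<in> {1..N}"
  then have "i \<le> N" "N + 1 - i \<le> N" by auto
  then show "(tmap s (coeff D' i) (tone s) \<circ> coeff D' (N + 1 - i)) - (tmap s (tone s) (coeff D' i) \<circ> coeff D' (N + 1 - i)) =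
      (tmap s (coeff D i) (tone s) \<circ> coeff D (N + 1 - i)) - (tmap s (tone s) (coeff D i) \<circ> coeff D (N + 1 - i))"
    by (simp only: assms)
qed

lemma obstruction_mor_cong:
  assumes "\<And>n. n \<le> N \<Longrightarrow> coeff DA' n = coeff DA n" "\<And>n. n \<le> N \<Longrightarrow> coeff DB' n = coeff DB n"
    and "\<And>n. n \<le> N \<Longrightarrow> coeff F' n = coeff F n"
  shows "obstruction_mor sB N DA' DB' F' = obstruction_mor sB N DA DB F"
proof -
  have "coeff DB' (N + 1 - i) \<circ> coeff F' i = coeff DB (N + 1 - i) \<circ> coeff F i" if "i \<in> {1..N}" for i
  proof -
    have "i \<le> N" "N + 1 - i \<le> N" using that by auto
    then show ?thesis by (simp only: assms)
  qed
  then show ?thesis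
    unfolding obstruction_mor_def
    by (intro arg_cong2[where f = "(-)"] sum.cong refl) (auto simp: assms)
qed

theorem theorem4p1:
  fixes sA :: "'k::field \<Rightarrow> 'a::ab_group_add \<Rightarrow> 'a" and \<Delta>A :: "'a \<Rightarrow> ('a list, 'k) tens"
    and sB :: "'k \<Rightarrow> 'b::ab_group_add \<Rightarrow> 'b" and \<Delta>B :: "'b \<Rightarrow> ('b list, 'k) tens"
    and f :: "'a \<Rightarrow> 'b" and N :: nat
    and \<Omega> :: "('a, 'b, 'k) coeff2 poly" and \<omega> :: "('a, 'b, 'k) coeff2"
  assumes "coalgebra_morphism sA \<Delta>A sB \<Delta>B f"
    and "N > 0"
    and "deformation sA \<Delta>A sB \<Delta>B f N \<Omega>"
    and "as_cochain sB \<omega> \<in> mor_cochains sA sB 2"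
  shows "deformation sA \<Delta>A sB \<Delta>B f (N + 1) (\<Omega> + monom \<omega> (N + 1)) \<longleftrightarrow>
    obstruction sA sB N \<Omega> = mor_coboundary sA \<Delta>A sB \<Delta>B f 2 (as_cochain sB \<omega>)"
proof -
  interpret coalgebra_morphism sA \<Delta>A sB \<Delta>B f by (rule assms(1))
  note A = A.vector_space_axioms and B = B.vector_space_axioms
  define \<Omega>' where "\<Omega>' = \<Omega> + monom \<omega> (Suc N)"
  have deg: "degree \<Omega> \<le> N" and zero: "coeff \<Omega> 0 = (\<Delta>A, \<Delta>B, f)"
    and hom_le: "\<And>n. n \<le> N \<Longrightarrow> as_cochain sB (coeff \<Omega> n) \<in> mor_cochains sA sB 2"
    and def: "coassoc_upto sA N (partA \<Omega>)" "coassoc_upto sB N (partB \<Omega>)"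
      "morphism_upto sB N (partA \<Omega>) (partB \<Omega>) (partF \<Omega>)"
    using assms(3) by (auto simp: deformation_def)
  \<comment> \<open>The degree bound makes the coefficient of \<open>\<Omega>\<close> at
    \<open>Suc N\<close> zero, so the added monomial puts exactly \<open>\<omega>\<close>
    there.\<close>
  have coeff': "coeff \<Omega>' n = (if n = Suc N then \<omega> else coeff \<Omega> n)" for n
    using coeff_eq_0[of \<Omega> "Suc N"] deg by (auto simp: \<Omega>'_def)
  have deg': "degree \<Omega>' \<le> Suc N"
    unfolding \<Omega>'_def by (intro degree_add_le degree_monom_le) (use deg in simp)
  \<comment> \<open>The criteria for passing from \<open>N\<close> to \<open>Suc N\<close> ask this
    of every coefficient; those beyond \<open>N\<close> are zero and thus cochains as well.\<close>
  have hom: "as_cochain sB (coeff \<Omega> n) \<in> mor_cochains sA sB 2" for n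
  proof (cases "n \<le> N")
    case False
    then have "coeff \<Omega> n = 0" using deg by (simp add: coeff_eq_0)
    then show ?thesis
      by (simp add: as_cochain_in_mor_cochains_2 zero_in_tensor_hom tone_comp_zero A B)
  qed (rule hom_le)
  then have hom': "as_cochain sB (coeff \<Omega>' n) \<in> mor_cochains sA sB 2" for n
    using assms(4) by (simp add: coeff')
  have parts: "coeff (partA P) n = fst (coeff P n)" "coeff (partB P) n = fst (snd (coeff P n))"
    "coeff (partF P) n = snd (snd (coeff P n))" for P :: "('a, 'b, 'k) coeff2 poly" and n
    by (simp_all add: coeff_map_poly)
  note hD = hom[unfolded as_cochain_in_mor_cochains_2, folded parts]
  note hD' = hom'[unfolded as_cochain_in_mor_cochains_2, folded parts]
  have same: "coeff (partA \<Omega>') n = coeff (partA \<Omega>) n" "coeff (partB \<Omega>') n = coeff (partB \<Omega>) n"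
    "coeff (partF \<Omega>') n = coeff (partF \<Omega>) n" if "n \<le> N" for n
    using that by (simp_all add: parts coeff')
  have "deformation sA \<Delta>A sB \<Delta>B f (Suc N) \<Omega>' \<longleftrightarrow>
      coassoc_upto sA (Suc N) (partA \<Omega>') \<and> coassoc_upto sB (Suc N) (partB \<Omega>') \<and>
      morphism_upto sB (Suc N) (partA \<Omega>') (partB \<Omega>') (partF \<Omega>')"
    using deg' hom' zero by (simp add: deformation_def coeff')
  \<comment> \<open>The criterion is applied to \<open>\<Omega>'\<close>. Its order \<open>N\<close>
    part holds because \<open>\<Omega>'\<close> agrees with the deformation \<open>\<Omega>\<close>
    up to \<open>N\<close>, and for the same reason the obstruction can be computed from
    \<open>\<Omega>\<close>.\<close>
  also have "coassoc_upto sA (Suc N) (partA \<Omega>') \<longleftrightarrow>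
      obstruction_comult sA N (partA \<Omega>) = coboundary_self sA \<Delta>A 2 (fst \<omega>)"
    using coassoc_upto_Suc[OF A, of "partA \<Omega>'" N] hD hD' def(1)
      coassoc_upto_cong[of "partA \<Omega>" sA "partA \<Omega>'" N] same(1)
      obstruction_comult_cong[of N "partA \<Omega>'" "partA \<Omega>" sA]
    by (simp add: parts coeff' zero)
  also have "coassoc_upto sB (Suc N) (partB \<Omega>') \<longleftrightarrow>
      obstruction_comult sB N (partB \<Omega>) = coboundary_self sB \<Delta>B 2 (fst (snd \<omega>))"
    using coassoc_upto_Suc[OF B, of "partB \<Omega>'" N] hD hD' def(2)
      coassoc_upto_cong[of "partB \<Omega>" sB "partB \<Omega>'" N] same(2)
      obstruction_comult_cong[of N "partB \<Omega>'" "partB \<Omega>" sB]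
    by (simp add: parts coeff' zero)
  also have "morphism_upto sB (Suc N) (partA \<Omega>') (partB \<Omega>') (partF \<Omega>') \<longleftrightarrow>
      obstruction_mor sB N (partA \<Omega>) (partB \<Omega>) (partF \<Omega>) =
      (fst (snd \<omega>) \<circ> f) - (tpower_map sB f \<circ> fst \<omega>)
      - coboundary_along sA \<Delta>A sB \<Delta>B f 1 (tone sB \<circ> snd (snd \<omega>))"
    using morphism_upto_Suc[OF B, of "partA \<Omega>'" sA "partB \<Omega>'" "partF \<Omega>'" N] hD hD' def(3)
      morphism_upto_cong[OF B, of "partA \<Omega>" sA "partB \<Omega>" "partA \<Omega>'" "partB \<Omega>'" N "partF \<Omega>'" "partF \<Omega>"] same
      obstruction_mor_cong[of N "partA \<Omega>'" "partA \<Omega>" "partB \<Omega>'" "partB \<Omega>" "partF \<Omega>'" "partF \<Omega>" sB]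
    by (simp add: parts coeff' zero)
  finally show ?thesis
    by (cases \<omega>) (simp add: \<Omega>'_def obstruction_def comp_def)
qed

end
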